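(* Let $\mathcal{A}=(a_i)_{i=1}^\infty$ be a weakly increasing sequence of positive integers and let $m\geq 2$ be an integer. Let $k\geq 4$ be an integer, and suppose that $\gcd A=1$ for every $(k-2)$-multisubset $A$ of the multiset $\{a_1,a_2,\ldots,a_k\}$. Put $D=\operatorname{lcm}(a_1,\ldots,a_k)$ and $\hat d=\frac{1}{k}\prod_{i=1}^k(1+iDk)$. If $2\hat d\geq 3m^3$, then $$p_\mathcal{A}(n,k)^2>p_\mathcal{A}(n+m,k)\,p_\mathcal{A}(n-m,k)$$ holds for all integers $n\geq \hat d$; otherwise this inequality holds for all integers $n\geq 3m$. Moreover, for the constant sequence $\mathcal{A}=(1,1,1,\ldots)$, the inequality holds for all positive integers $n$ and all $k\geq 2$.
   Context: For a weakly increasing sequence $\mathcal{A}=(a_i)_{i\ge1}$ of positive integers and a positive integer $k$, the restricted partition function $p_\mathcal{A}(n,k)$ is defined by $\sum_{n\ge0}p_\mathcal{A}(n,k)x^n=\prod_{i=1}^k(1-x^{a_i})^{-1}$; equivalently, it counts the partitions of $n$ whose parts lie in the multiset $\{a_1,\ldots,a_k\}$ (equal values $a_i=a_j$ with $i\ne j$ are treated as distinct "colors" of a part; order of parts is irrelevant). Thus $p_\mathcal{A}(0,k)=1$, and $p_\mathcal{A}(n,k)=0$ for $n<0$. A $j$-multisubset of $\{a_1,\ldots,a_k\}$ is a sub-multiset obtained by choosing $j$ of the $k$ indices. *)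

theory Defs
  imports Complex_Main
begin

text \<open>Restricted partition function: number of ways to write n as
  c_1 a_1 + ... + c_k a_k with c_i natural numbers (parts a_i with equal values
  but different indices count as different colours). For negative n it is 0.\<close>
definition restricted_partition :: "(nat \<Rightarrow> nat) \<Rightarrow> int \<Rightarrow> nat \<Rightarrow> nat" where
  "restricted_partition a n k =
     card {c :: nat \<Rightarrow> nat. (\<forall>i. i \<notin> {1..k} \<longrightarrow> c i = 0) \<and>
                         (\<Sum>i=1..k. int (c i * a i)) = n}"

end

theory Submission
  imports Defs
    "HOL-Computational_Algebra.Polynomial_Factorial"
    "HOL-Computational_Algebra.Polynomial_FPS"
    "HOL-Computational_Algebra.Field_as_Ring"
begin

text \<open>
  Write \<open>K = k - 1\<close> and \<open>N(x) = \<Prod>(1 - x^D) / (1 - x^a\<^sub>i) = \<Sum> \<nu>\<^sub>t x^t\<close>, a polynomial with nonnegative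
  coefficients. The generating function is \<open>N(x) / (1 - x^D)^k\<close>, so for \<open>n \<ge> k D\<close>
  the value \<open>p(n)\<close> is \<open>1 / (D^K K!)\<close> times the sum of \<open>\<nu>\<^sub>t \<Prod>\<^sub>l\<^sub>\<le>\<^sub>K (n - t + l D)\<close> over \<open>t \<equiv> n\<close>
  modulo \<open>D\<close>. The gcd hypothesis makes \<open>(1 + x + \<dots> + x^(D-1))^3\<close> divide \<open>N\<close>, so the moments
  of order 0, 1, 2 of \<open>\<nu>\<close> over a residue class do not depend on the class. Hence
  \<open>p(n) = C n^(k-3) (n^2 + \<alpha> n + \<beta> + \<delta>(n))\<close> with \<open>\<delta>(n) = O(Y^3 / n)\<close>, where \<open>Y = K^2 D\<close>.
  Both thresholds on \<open>n\<close> give \<open>n \<ge> 3 m\<close> and \<open>m^2 n \<ge> 4 Y^3\<close>, because \<open>2 Y^3\<close> is at most the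
  product bound of the theorem; then \<open>\<delta>\<close> is a small multiple of \<open>m^2\<close>, too small to destroy the
  strict log-concavity of the quadratic factor.
\<close>

subsection \<open>Generating functions\<close>

lemma restricted_partition_neg: "n < 0 \<Longrightarrow> restricted_partition a n k = 0"
proof -
  assume "n < 0"
  moreover have "0 \<le> (\<Sum>i=1..k. int (c i * a i))" for c
    by (rule sum_nonneg) simp
  ultimately have "{c. (\<forall>i. i \<notin> {1..k} \<longrightarrow> c i = 0) \<and> (\<Sum>i=1..k. int (c i * a i)) = n} = {}"
    by (metis (mono_tags, lifting) empty_Collect_eq linorder_not_less)
  then show ?thesis unfolding restricted_partition_def by (simp only: card.empty)
qed

lemma restricted_partition_0: "restricted_partition a n 0 = (if n = 0 then 1 else 0)"
proof -
  have "{c :: nat \<Rightarrow> nat. \<forall>i. c i = 0} = {\<lambda>_. 0}" by auto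
  then show ?thesis unfolding restricted_partition_def by simp
qed

lemma finite_partitions:
  assumes "\<And>i. i \<in> {1..k} \<Longrightarrow> 0 < a i"
  shows "finite {c :: nat \<Rightarrow> nat. (\<forall>i. i \<notin> {1..k} \<longrightarrow> c i = 0) \<and> (\<Sum>i=1..k. int (c i * a i)) = n}"
proof (rule finite_subset)
  show "finite {c. \<forall>i. (i \<in> {1..k} \<longrightarrow> c i \<in> {..nat n}) \<and> (i \<notin> {1..k} \<longrightarrow> c i = (0::nat))}"
    by (rule finite_set_of_finite_funs) auto
  show "{c :: nat \<Rightarrow> nat. (\<forall>i. i \<notin> {1..k} \<longrightarrow> c i = 0) \<and> (\<Sum>i=1..k. int (c i * a i)) = n} \<subseteq>
      {c. \<forall>i. (i \<in> {1..k} \<longrightarrow> c i \<in> {..nat n}) \<and> (i \<notin> {1..k} \<longrightarrow> c i = (0::nat))}"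
  proof clarify
    fix c :: "nat \<Rightarrow> nat" and i
    assume zero: "\<forall>i. i \<notin> {1..k} \<longrightarrow> c i = 0" and n: "n = (\<Sum>i=1..k. int (c i * a i))"
    have "c i \<le> nat (\<Sum>i=1..k. int (c i * a i))" if i: "i \<in> {1..k}"
    proof -
      have "int (c i) \<le> int (c i * a i)"
        using assms[OF i] by (metis Suc_leI mult.right_neutral mult_le_mono2 of_nat_mono One_nat_def)
      also have "\<dots> \<le> (\<Sum>i=1..k. int (c i * a i))"
        using i by (intro member_le_sum) auto
      finally show ?thesis by linarith
    qed
    then show "(i \<in> {1..k} \<longrightarrow> c i \<in> {..nat (\<Sum>i=1..k. int (c i * a i))}) \<and> (i \<notin> {1..k} \<longrightarrow> c i = 0)"
      using zero by auto
  qed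
qed

lemma restricted_partition_Suc:
  assumes "\<And>i. i \<in> {1..Suc k} \<Longrightarrow> 0 < a i"
  shows "restricted_partition a n (Suc k) =
    restricted_partition a n k + restricted_partition a (n - int (a (Suc k))) (Suc k)"
proof -
  define S where "S = (\<lambda>n k. {c :: nat \<Rightarrow> nat. (\<forall>i. i \<notin> {1..k} \<longrightarrow> c i = 0) \<and>
                         (\<Sum>i=1..k. int (c i * a i)) = n})"
  define inc where "inc = (\<lambda>c :: nat \<Rightarrow> nat. c(Suc k := Suc (c (Suc k))))"
  have rp: "restricted_partition a n k = card (S n k)" for n k
    by (simp add: restricted_partition_def S_def)
  have fin: "finite (S n (Suc k))" for n
    unfolding S_def by (rule finite_partitions) (use assms in auto)
  have fin': "finite (S n k)"
    unfolding S_def by (rule finite_partitions) (use assms in auto)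
  have inj: "inj_on inc X" for X
  proof (rule inj_onI)
    fix c d assume "inc c = inc d"
    then have "inc c i = inc d i" for i by simp
    then show "c = d" unfolding inc_def by (metis Suc_inject ext fun_upd_apply)
  qed
  have sum_cong_upd: "(\<Sum>i=1..k. int ((c(Suc k := v)) i * a i)) = (\<Sum>i=1..k. int (c i * a i))" for c v
    by (rule sum.cong) auto
  have "S n (Suc k) = S n k \<union> inc ` S (n - int (a (Suc k))) (Suc k)"
  proof (intro equalityI subsetI)
    fix c assume c: "c \<in> S n (Suc k)"
    show "c \<in> S n k \<union> inc ` S (n - int (a (Suc k))) (Suc k)"
    proof (cases "c (Suc k)")
      case 0
      then have "c \<in> S n k" using c unfolding S_def
        by (auto simp: le_Suc_eq)
      then show ?thesis by simp
    next
      case (Suc v)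
      define d where "d = c(Suc k := v)"
      have "inc d = c" using Suc by (auto simp: inc_def d_def)
      moreover have "d \<in> S (n - int (a (Suc k))) (Suc k)"
        using c Suc sum_cong_upd[of c v] unfolding S_def d_def
        by (auto simp: algebra_simps)
      ultimately show ?thesis by blast
    qed
  next
    fix c assume "c \<in> S n k \<union> inc ` S (n - int (a (Suc k))) (Suc k)"
    then show "c \<in> S n (Suc k)"
    proof
      assume "c \<in> S n k"
      then show ?thesis unfolding S_def by auto
    next
      assume "c \<in> inc ` S (n - int (a (Suc k))) (Suc k)"
      then obtain d where "c = inc d" and d: "d \<in> S (n - int (a (Suc k))) (Suc k)" by blast
      then show ?thesis using sum_cong_upd[of d "Suc (d (Suc k))"] unfolding S_def inc_def
        by (auto simp: algebra_simps)
    qed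
  qed
  moreover have "S n k \<inter> inc ` S (n - int (a (Suc k))) (Suc k) = {}"
  proof -
    have "inc c (Suc k) \<noteq> 0" for c by (simp add: inc_def)
    moreover have "c (Suc k) = 0" if "c \<in> S n k" for c using that by (simp add: S_def)
    ultimately show ?thesis by blast
  qed
  ultimately show ?thesis
    unfolding rp using fin fin' by (simp add: card_Un_disjoint card_image inj)
qed

definition partition_series :: "(nat \<Rightarrow> nat) \<Rightarrow> nat \<Rightarrow> real fps" where
  "partition_series a k = Abs_fps (\<lambda>n. real (restricted_partition a (int n) k))"

lemma partition_series_Suc:
  assumes "\<And>i. i \<in> {1..Suc k} \<Longrightarrow> 0 < a i"
  shows "(1 - fps_X ^ a (Suc k)) * partition_series a (Suc k) = partition_series a k"
proof (rule fps_ext)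
  fix n
  have *: "restricted_partition a (int n) (Suc k) = restricted_partition a (int n) k
      + restricted_partition a (int n - int (a (Suc k))) (Suc k)"
    by (rule restricted_partition_Suc) (use assms in auto)
  show "fps_nth ((1 - fps_X ^ a (Suc k)) * partition_series a (Suc k)) n = fps_nth (partition_series a k) n"
    using * by (auto simp: partition_series_def algebra_simps fps_X_power_mult_nth
        restricted_partition_neg of_nat_diff)
qed

lemma partition_series_eq:
  assumes "\<And>i. i \<in> {1..k} \<Longrightarrow> 0 < a i"
  shows "(\<Prod>i=1..k. 1 - fps_X ^ a i) * partition_series a k = 1"
  using assms
proof (induction k)
  case 0
  show ?case by (rule fps_ext) (simp add: partition_series_def restricted_partition_0)
next
  case (Suc k)
  have "(\<Prod>i=1..Suc k. 1 - fps_X ^ a i) * partition_series a (Suc k)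
      = (\<Prod>i=1..k. 1 - fps_X ^ a i) * ((1 - fps_X ^ a (Suc k)) * partition_series a (Suc k))"
    by (simp add: mult_ac)
  also have "\<dots> = 1"
    using Suc partition_series_Suc[of k a] by simp
  finally show ?case .
qed

section \<open>Constant sequences\<close>

text \<open>These are the coefficients of \<open>1 / (1 - x^d)^(k+1)\<close>. Removing one copy of
  \<open>d\<close> lowers \<open>n div d\<close> by one, so the recurrence becomes Pascal's rule;
  hence an induction on \<open>n\<close> inside the induction on \<open>k\<close>.\<close>

lemma restricted_partition_const:
  assumes "0 < d"
  shows "restricted_partition (\<lambda>_. d) (int n) (Suc k) =
    (if d dvd n then (n div d + k) choose k else 0)"
proof (induction k arbitrary: n)
  case 0
  show ?case
  proof (induction n rule: less_induct)
    case (less n)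
    have rec: "restricted_partition (\<lambda>_. d) (int n) (Suc 0) = (if n = 0 then 1 else 0)
      + restricted_partition (\<lambda>_. d) (int n - int d) (Suc 0)"
      using assms by (subst restricted_partition_Suc) (auto simp: restricted_partition_0)
    show ?case
    proof (cases "n < d")
      case True
      then show ?thesis using rec
        by (auto simp: restricted_partition_neg dest: dvd_imp_le)
    next
      case False
      then have eq: "int n - int d = int (n - d)" by simp
      have dvd: "d dvd n - d \<longleftrightarrow> d dvd n" using False by (simp add: dvd_minus_self)
      have "n - d < n" "n \<noteq> 0" using False assms by auto
      then show ?thesis unfolding rec eq by (subst less) (simp_all add: dvd)
    qed
  qed
next
  case (Suc k)
  note outer = Suc
  show ?case
  proof (induction n rule: less_induct)
    case (less n)
    have rec: "restricted_partition (\<lambda>_. d) (int n) (Suc (Suc k)) =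
       restricted_partition (\<lambda>_. d) (int n) (Suc k)
      + restricted_partition (\<lambda>_. d) (int n - int d) (Suc (Suc k))"
      using assms by (subst restricted_partition_Suc) auto
    show ?case
    proof (cases "n < d")
      case True
      then show ?thesis using rec outer[of n]
        by (auto simp: restricted_partition_neg dest: dvd_imp_le)
    next
      case False
      then have eq: "int n - int d = int (n - d)" by simp
      have dvd: "d dvd n - d \<longleftrightarrow> d dvd n" using False by (simp add: dvd_minus_self)
      have "n div d = Suc ((n - d) div d)"
        using False assms by (simp add: le_div_geq)
      moreover have "n - d < n" using False assms by auto
      ultimately show ?thesis unfolding rec eq outer by (subst less) (simp_all add: dvd)
    qed
  qed
qed

text \<open>Splits the binomial coefficient, as a polynomial in \<open>u\<close>, into linear
  factors. Both the constant case and the exact formula for general sequences work with these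
  factors.\<close>

lemma binomial_eq_prod: "real ((u + K) choose K) = (\<Prod>l=1..K. real u + real l) / fact K"
proof (induction K)
  case (Suc K)
  have "real (Suc K) * real (Suc (u + K) choose Suc K) = real (Suc (u + K)) * real ((u + K) choose K)"
    using Suc_times_binomial_eq[of "u + K" K] by (metis of_nat_mult mult.commute)
  then have "real (Suc (u + K) choose Suc K) = real (Suc (u + K)) * real ((u + K) choose K) / real (Suc K)"
    by (simp add: field_simps del: of_nat_Suc)
  then show ?case using Suc by (simp add: mult.commute add.commute add.left_commute)
qed simp

text \<open>Pairing the linear factors at \<open>u + m\<close> and \<open>u - m\<close> gives
  \<open>(u + l)^2 - m^2\<close>, which is less than the corresponding factor
  \<open>(u + l)^2\<close> of the square.\<close>

lemma log_concave_const_one: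
  assumes "2 \<le> k" "0 < n" "0 < m"
  shows "restricted_partition (\<lambda>_. 1) n k ^ 2 >
        restricted_partition (\<lambda>_. 1) (n + int m) k * restricted_partition (\<lambda>_. 1) (n - int m) k"
proof -
  define K where "K = k - 1"
  have K: "k = Suc K" "1 \<le> K" using assms by (auto simp: K_def)
  obtain u where n: "n = int u" and "0 < u" using assms by (metis zero_less_imp_eq_int)
  have val: "restricted_partition (\<lambda>_. 1) (int v) k = (v + K) choose K" for v
    using restricted_partition_const[of 1 v K] K by simp
  show ?thesis
  proof (cases "u < m")
    \<comment> \<open>The count at \<open>n - m\<close> vanishes, while the left side is the square
      of a positive binomial coefficient.\<close>
    case True
    then show ?thesis using n val[of u] by (simp add: restricted_partition_neg)
  next
    case False
    have val': "real (restricted_partition (\<lambda>_. 1) (int v) k) = (\<Prod>l=1..K. real v + real l) / fact K" for v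
      by (simp only: val binomial_eq_prod)
    have "(\<Prod>l=1..K. real (u + m) + real l) * (\<Prod>l=1..K. real (u - m) + real l)
        = (\<Prod>l=1..K. (real u + real l)^2 - real m ^ 2)"
      using False by (simp flip: prod.distrib) (simp add: of_nat_diff algebra_simps power2_eq_square)
    also have "\<dots> < (\<Prod>l=1..K. (real u + real l)^2)"
    proof (rule prod_mono_strict)
      fix l assume "l \<in> {1..K}"
      have "real m ^ 2 \<le> (real u + real l)^2" using False by (intro power_mono) auto
      then show "0 \<le> (real u + real l)^2 - real m ^ 2 \<and> (real u + real l)^2 - real m ^ 2 \<le> (real u + real l)^2"
        by auto
    qed (use K assms in \<open>auto simp: zero_less_power2 add_nonneg_eq_0_iff\<close>)
    also have "\<dots> = (\<Prod>l=1..K. real u + real l)^2" by (simp add: prod_power_distrib)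
    finally have "real (restricted_partition (\<lambda>_. 1) (int (u + m)) k) * real (restricted_partition (\<lambda>_. 1) (int (u - m)) k)
       < real (restricted_partition (\<lambda>_. 1) (int u) k) ^ 2"
      unfolding val' by (simp add: field_simps power2_eq_square)
    then show ?thesis using n False
      by (simp add: of_nat_diff flip: of_nat_mult of_nat_power)
  qed
qed

subsection \<open>The numerator polynomial and its residue moments\<close>

text \<open>For \<open>a dvd d\<close> this is the quotient \<open>(1 - x^d) / (1 - x^a)\<close>; in
  particular \<open>geometric_poly d 1\<close> is \<open>1 + x + ... + x^(d-1)\<close>.\<close>

definition geometric_poly :: "nat \<Rightarrow> nat \<Rightarrow> real poly" where
  "geometric_poly d a = (\<Sum>j<d div a. monom 1 (a * j))"

lemma geometric_poly_mult:
  assumes "a dvd d"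
  shows "(monom 1 a - 1) * geometric_poly d a = monom 1 d - 1"
proof -
  have "(monom 1 a :: real poly) ^ (d div a) - 1 = (monom 1 a - 1) * (\<Sum>j<d div a. monom 1 a ^ j)"
    by (rule power_diff_1_eq)
  then show ?thesis using assms by (simp add: geometric_poly_def monom_power)
qed

lemma monom_minus_one_nonzero: "0 < d \<Longrightarrow> monom 1 d - 1 \<noteq> (0 :: real poly)"
proof
  assume "0 < d" "monom 1 d - 1 = (0 :: real poly)"
  then have "coeff (monom 1 d - 1 :: real poly) d = 0" by simp
  with \<open>0 < d\<close> show False by simp
qed

section \<open>Common divisors of the polynomials \<open>x^a - 1\<close>\<close>

text \<open>The subtractive Euclidean algorithm, run on the exponents.\<close>

lemma dvd_monom_minus_one_gcd:
  fixes p :: "real poly"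
  assumes "p dvd monom 1 a - 1" "p dvd monom 1 b - 1"
  shows "p dvd monom 1 (gcd a b) - 1"
  using assms
proof (induction "a + b" arbitrary: a b rule: less_induct)
  case less
  have step: "p dvd monom 1 (y - x) - 1"
    if "x \<le> y" "p dvd monom 1 x - 1" "p dvd monom 1 y - 1" for x y
  proof -
    have "monom 1 (y - x) - 1 = (monom 1 y - 1) - monom 1 (y - x) * (monom 1 x - 1 :: real poly)"
      using that(1) by (simp add: algebra_simps mult_monom)
    then show ?thesis using that by (metis dvd_diff dvd_mult)
  qed
  consider "a = 0" | "b = 0" | "0 < a" "a \<le> b" | "0 < b" "b < a" by linarith
  then show ?case
  proof cases
    case 3
    then have "p dvd monom 1 (gcd a (b - a)) - 1"
      using less step[of a b] by (intro less) auto
    then show ?thesis using 3 by (metis gcd.commute gcd_diff1_nat)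
  next
    case 4
    then have "p dvd monom 1 (gcd (a - b) b) - 1"
      using less step[of b a] by (intro less) auto
    then show ?thesis using 4 by (simp add: gcd_diff1_nat less_imp_le)
  qed (use less in auto)
qed

lemma dvd_monom_minus_one_Gcd:
  fixes p :: "real poly"
  assumes "finite S" "\<And>i. i \<in> S \<Longrightarrow> p dvd monom 1 (a i) - 1"
  shows "p dvd monom 1 (Gcd (a ` S)) - 1"
  using assms
proof (induction S rule: finite_induct)
  case empty
  \<comment> \<open>The gcd of the empty set is 0, and \<open>x^0 - 1\<close> is the zero
    polynomial, which everything divides.\<close>
  show ?case by (simp add: monom_0 one_pCons)
next
  case (insert i S)
  then have "p dvd monom 1 (gcd (a i) (Gcd (a ` S))) - 1"
    by (intro dvd_monom_minus_one_gcd) simp_all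
  then show ?case by simp
qed

text \<open>Squarefreeness of \<open>x^d - 1\<close>: a repeated factor divides the derivative
  \<open>d x^(d-1)\<close>, hence \<open>x^d\<close>, hence the difference 1 of \<open>x^d\<close>
  and \<open>x^d - 1\<close>.\<close>

lemma square_dvd_monom_minus_one_imp_unit:
  fixes p :: "real poly"
  assumes "p * p dvd monom 1 d - 1" "0 < d"
  shows "is_unit p"
proof -
  obtain q where q: "monom 1 d - 1 = p * p * q" using assms by (auto simp: dvd_def)
  have "pderiv (monom 1 d - 1) = p * (p * pderiv q + 2 * q * pderiv p)"
    unfolding q by (simp add: pderiv_mult algebra_simps)
  moreover have "pderiv (monom 1 d - 1 :: real poly) = monom (real d) (d - 1)"
    by (simp add: pderiv_diff pderiv_monom)
  ultimately have "p dvd monom (real d) (d - 1)" by (metis dvd_triv_left)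
  then have "p dvd monom (1 / real d) 1 * monom (real d) (d - 1)" by (rule dvd_mult)
  moreover have "monom (1 / real d) 1 * monom (real d) (d - 1) = monom 1 d"
    using assms by (simp add: mult_monom)
  ultimately have "p dvd monom 1 d" by simp
  moreover have "p dvd monom 1 d - 1" using q by (metis dvd_triv_left mult.assoc)
  ultimately have "p dvd monom 1 d - (monom 1 d - 1)" by (rule dvd_diff)
  then show ?thesis by simp
qed

text \<open>A prime divisor \<open>p\<close> of \<open>1 + x + \<dots> + x^(d-1)\<close> does not divide \<open>x - 1\<close>, so by the gcd
  hypothesis it divides fewer than \<open>card I - 2\<close> of the polynomials \<open>x^(a i) - 1\<close>, hence at least
  three of the cofactors.\<close>
lemma cube_dvd_prod_geometric_poly:
  assumes "finite I" "0 < d" and dvd: "\<And>i. i \<in> I \<Longrightarrow> a i dvd d"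
    and gcd: "\<And>S. S \<subseteq> I \<Longrightarrow> card S = card I - 2 \<Longrightarrow> Gcd (a ` S) = 1"
  shows "geometric_poly d 1 ^ 3 dvd (\<Prod>i\<in>I. geometric_poly d (a i))"
\<comment> \<open>Real polynomials form a factorial ring, so multiplicities are compared prime by
  prime.\<close>
proof (rule multiplicity_le_imp_dvd)
  let ?W = "geometric_poly d 1"
  have W: "(monom 1 1 - 1) * ?W = monom 1 d - 1" by (rule geometric_poly_mult) simp
  have nz: "geometric_poly d (a i) \<noteq> 0" if "i \<in> I" for i
    using geometric_poly_mult[OF dvd[OF that]] monom_minus_one_nonzero[OF \<open>0 < d\<close>] by auto
  have W0: "?W \<noteq> 0" using W monom_minus_one_nonzero[OF \<open>0 < d\<close>] by auto
  then show "?W ^ 3 \<noteq> 0" by simp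
  fix p :: "real poly" assume p: "prime p"
  then have unit: "\<not> is_unit p" by (auto simp: prime_def prime_elem_def)
  have mult_W3: "multiplicity p (?W ^ 3) = 3 * multiplicity p ?W"
    using p W0 by (simp add: prime_elem_multiplicity_power_distrib prime_imp_prime_elem)
  show "multiplicity p (?W ^ 3) \<le> multiplicity p (\<Prod>i\<in>I. geometric_poly d (a i))"
  proof (cases "p dvd ?W")
    case False
    then show ?thesis using mult_W3 by (simp add: not_dvd_imp_multiplicity_0)
  next
    case True
    have sqfree: "\<not> (p dvd f \<and> p dvd g)" if "f * g = monom 1 d - 1" for f g
      using that square_dvd_monom_minus_one_imp_unit[of p d] unit \<open>0 < d\<close> mult_dvd_mono by metis
    have not_lin: "\<not> p dvd monom 1 1 - 1" using sqfree[OF W] True by blast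
    \<comment> \<open>Since \<open>?W\<close> divides the squarefree \<open>x^d - 1\<close>, the
      prime \<open>p\<close> has multiplicity at most 3 in \<open>?W ^ 3\<close>; three cofactors
      divisible by \<open>p\<close> are therefore enough.\<close>
    have "\<not> p ^ 2 dvd ?W"
    proof
      assume "p ^ 2 dvd ?W"
      then have "p * p dvd monom 1 d - 1" using W by (metis dvd_mult power2_eq_square)
      then show False using square_dvd_monom_minus_one_imp_unit unit \<open>0 < d\<close> by blast
    qed
    then have "multiplicity p (?W ^ 3) \<le> 3"
      using multiplicity_lessI[of ?W p 2] W0 unit mult_W3 by auto
    define B where "B = {i \<in> I. p dvd monom 1 (a i) - 1}"
    define T where "T = I - B"
    have "card B < card I - 2"
    proof (rule ccontr)
      assume "\<not> ?thesis"
      then obtain S where S: "S \<subseteq> B" "card S = card I - 2"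
        by (metis linorder_not_less obtain_subset_with_card_n)
      then have "finite S" "S \<subseteq> I"
        using \<open>finite I\<close> by (auto simp: B_def intro: finite_subset[of _ I])
      then have "p dvd monom 1 (Gcd (a ` S)) - 1"
        using S by (intro dvd_monom_minus_one_Gcd) (auto simp: B_def)
      then show False using gcd[OF \<open>S \<subseteq> I\<close> S(2)] not_lin by simp
    qed
    moreover have "card T = card I - card B" unfolding T_def
      using \<open>finite I\<close> by (intro card_Diff_subset) (auto simp: B_def)
    ultimately have card_T: "3 \<le> card T" by linarith
    have "p dvd geometric_poly d (a i)" if "i \<in> T" for i
    proof -
      have "p dvd (monom 1 (a i) - 1) * geometric_poly d (a i)"
        using geometric_poly_mult[of "a i" d] dvd that True W unfolding T_def
        by (metis Diff_iff dvd_mult)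
      then show ?thesis using that p by (auto simp: T_def B_def prime_dvd_mult_iff)
    qed
    then have "(\<Prod>i\<in>T. p) dvd (\<Prod>i\<in>T. geometric_poly d (a i))" by (rule prod_dvd_prod)
    then have "p ^ card T dvd (\<Prod>i\<in>T. geometric_poly d (a i))" by simp
    then have "p ^ 3 dvd (\<Prod>i\<in>T. geometric_poly d (a i))"
      using card_T by (meson dvd_trans le_imp_power_dvd)
    also have "\<dots> dvd (\<Prod>i\<in>I. geometric_poly d (a i))"
      by (rule prod_dvd_prod_subset) (use \<open>finite I\<close> in \<open>auto simp: T_def\<close>)
    finally have "3 \<le> multiplicity p (\<Prod>i\<in>I. geometric_poly d (a i))"
      using nz \<open>finite I\<close> unit by (intro multiplicity_geI) auto
    with \<open>multiplicity p (?W ^ 3) \<le> 3\<close> show ?thesis by simp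
  qed
qed

section \<open>Coefficient sums over residue classes\<close>

text \<open>The residue is an integer, not reduced modulo \<open>d\<close>, so that multiplication
  by \<open>x\<close> simply replaces \<open>r\<close> by \<open>r - 1\<close>.\<close>

definition residue_sum :: "nat \<Rightarrow> int \<Rightarrow> real poly \<Rightarrow> real" where
  "residue_sum d r p = (\<Sum>t\<le>degree p. if int d dvd int t - r then coeff p t else 0)"

lemma residue_sum_altdef:
  assumes "degree p \<le> n"
  shows "residue_sum d r p = (\<Sum>t\<le>n. if int d dvd int t - r then coeff p t else 0)"
  unfolding residue_sum_def
  by (rule sum.mono_neutral_left) (use assms in \<open>auto simp: coeff_eq_0\<close>)

lemma residue_sum_add: "residue_sum d r (p + q) = residue_sum d r p + residue_sum d r q"
proof -
  define n where "n = max (degree p) (degree q)"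
  have "degree (p + q) \<le> n" "degree p \<le> n" "degree q \<le> n"
    by (auto simp: n_def intro: degree_add_le_max)
  then show ?thesis
    by (simp add: residue_sum_altdef[where n = n] flip: sum.distrib) (rule sum.cong, auto)
qed

lemma residue_sum_smult: "residue_sum d r (smult c p) = c * residue_sum d r p"
  by (simp add: residue_sum_altdef[where n = "degree p"] degree_smult_le sum_distrib_left) (rule sum.cong, simp_all)

lemma residue_sum_shift: "residue_sum d r (pCons 0 p) = residue_sum d (r - 1) p"
proof -
  have "residue_sum d r (pCons 0 p) =
      (\<Sum>t\<le>Suc (degree p). if int d dvd int t - r then coeff (pCons 0 p) t else 0)"
    by (rule residue_sum_altdef) (rule degree_pCons_le)
  also have "\<dots> = residue_sum d (r - 1) p"
    unfolding residue_sum_def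
    by (subst sum.atMost_Suc_shift) (auto simp: algebra_simps intro!: sum.cong)
  finally show ?thesis .
qed

lemma degree_geometric_poly: "degree (geometric_poly d a) \<le> d"
  unfolding geometric_poly_def
proof (rule degree_sum_le)
  fix j assume "j \<in> {..<d div a}"
  then have "a * j \<le> a * (d div a)" by simp
  also have "\<dots> \<le> d" by simp
  finally show "degree (monom (1 :: real) (a * j)) \<le> d"
    using degree_monom_le le_trans by blast
qed simp

lemma coeff_geometric_poly_nonneg: "0 \<le> coeff (geometric_poly d a) t"
  unfolding geometric_poly_def by (auto simp: coeff_sum intro!: sum_nonneg)

lemma coeff_geometric_poly_1: "coeff (geometric_poly d 1) t = (if t < d then 1 else 0)"
  unfolding geometric_poly_def by (simp add: coeff_sum)

text \<open>Every residue class contains exactly one exponent below \<open>d\<close>, and its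
  coefficient is 1.\<close>

lemma residue_sum_geometric_poly:
  assumes "0 < d"
  shows "residue_sum d r (geometric_poly d 1) = 1"
proof -
  have eq: "(t < d \<and> int d dvd int t - r) \<longleftrightarrow> t = nat (r mod int d)" for t
  proof
    assume t: "t < d \<and> int d dvd int t - r"
    then have "int t mod int d = r mod int d" by (simp only: mod_eq_dvd_iff)
    moreover have "int t mod int d = int t" using t by simp
    ultimately show "t = nat (r mod int d)" by simp
  next
    assume t: "t = nat (r mod int d)"
    then have "int t = r mod int d" using assms by simp
    then show "t < d \<and> int d dvd int t - r"
      using assms by (metis mod_eq_dvd_iff mod_mod_trivial of_nat_0_less_iff of_nat_less_iff pos_mod_bound)
  qed
  have "residue_sum d r (geometric_poly d 1) =
      (\<Sum>t\<le>d. if int d dvd int t - r then coeff (geometric_poly d 1) t else 0)"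
    by (rule residue_sum_altdef) (rule degree_geometric_poly)
  also have "\<dots> = (\<Sum>t\<le>d. if t = nat (r mod int d) then 1 else 0)"
    by (rule sum.cong) (auto simp: coeff_geometric_poly_1[unfolded One_nat_def] simp flip: eq)
  also have "\<dots> = 1" using eq[of "nat (r mod int d)"] by simp
  finally show ?thesis .
qed

text \<open>Multiplication by \<open>x\<close> only permutes the residue classes, so
  equidistribution passes from \<open>geometric_poly d 1\<close> to all its multiples. The induction
  builds the cofactor in Horner form: passing from \<open>q\<close> to \<open>a + x q\<close>
  changes the common value from \<open>c\<close> to \<open>a + c\<close>.\<close>

lemma residue_sum_dvd:
  assumes "0 < d" "geometric_poly d 1 dvd p"
  shows "residue_sum d r p = residue_sum d s p"
proof -
  have "\<exists>c. \<forall>r. residue_sum d r (geometric_poly d 1 * q) = c" for q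
  proof (induction q)
    case 0
    have "residue_sum d r 0 = 0" for r by (simp add: residue_sum_def cong: if_cong)
    then show ?case by simp
  next
    case (pCons a q)
    then obtain c where "\<forall>r. residue_sum d r (geometric_poly d 1 * q) = c" by blast
    then have "residue_sum d r (geometric_poly d 1 * pCons a q) = a + c" for r
      by (simp add: mult_pCons_right residue_sum_add residue_sum_smult residue_sum_shift
          residue_sum_geometric_poly[unfolded One_nat_def] assms)
    then show ?case by blast
  qed
  then show ?thesis using assms(2) by (metis dvdE)
qed

section \<open>Moments over residue classes\<close>

text \<open>The operator \<open>x d/dx\<close>. It multiplies the coefficient of \<open>x^t\<close>
  by \<open>t\<close>, so its iterates turn moments into plain residue sums.\<close>

definition euler_op :: "real poly \<Rightarrow> real poly" where
  "euler_op p = pCons 0 (pderiv p)"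

lemma coeff_euler_op: "coeff (euler_op p) t = real t * coeff p t"
  by (cases t) (auto simp: euler_op_def coeff_pderiv)

lemma coeff_euler_op_power: "coeff ((euler_op ^^ e) p) t = real t ^ e * coeff p t"
  by (induction e) (auto simp: coeff_euler_op)

lemma degree_euler_op_power: "degree ((euler_op ^^ e) p) \<le> degree p"
  by (rule degree_le) (auto simp: coeff_euler_op_power coeff_eq_0)

text \<open>By the product rule, one differentiation costs at most one factor
  \<open>w\<close>.\<close>

lemma power_dvd_euler_op:
  assumes "w ^ Suc j dvd p"
  shows "w ^ j dvd euler_op p"
proof -
  obtain q where p: "p = w ^ Suc j * q" using assms by (auto simp: dvd_def)
  have "w ^ j dvd pderiv p" unfolding p pderiv_mult pderiv_power_Suc
    by (intro dvd_add) (auto simp: dvd_smult)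
  then have "w ^ j dvd [:0, 1:] * pderiv p" by (rule dvd_mult)
  then show ?thesis by (simp add: euler_op_def)
qed

lemma power_dvd_euler_op_power:
  "w ^ (e + j) dvd p \<Longrightarrow> w ^ j dvd (euler_op ^^ e) p"
proof (induction e arbitrary: j)
  case (Suc e)
  then have "w ^ (e + Suc j) dvd p" by simp
  then have "w ^ Suc j dvd (euler_op ^^ e) p" by (rule Suc.IH)
  then show ?case using power_dvd_euler_op by simp
qed simp

text \<open>At most two applications of the Euler operator use up at most two of the three factors
  \<open>geometric_poly d 1\<close>; the remaining one makes the residue sums independent of the
  class.\<close>

lemma residue_moment:
  assumes "0 < d" "geometric_poly d 1 ^ 3 dvd p" "e \<le> 2"
  shows "(\<Sum>t\<le>degree p. if int d dvd int t - r then real t ^ e * coeff p t else 0) =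
    (\<Sum>t\<le>degree p. if int d dvd int t - s then real t ^ e * coeff p t else 0)"
proof -
  have "e + 1 \<le> 3" using assms by simp
  then have "geometric_poly d 1 ^ (e + 1) dvd p"
    using assms(2) by (meson dvd_trans le_imp_power_dvd)
  then have "geometric_poly d 1 dvd (euler_op ^^ e) p"
    using power_dvd_euler_op_power[of "geometric_poly d 1" e 1] by simp
  then have "residue_sum d r ((euler_op ^^ e) p) = residue_sum d s ((euler_op ^^ e) p)"
    using assms(1) by (intro residue_sum_dvd)
  then show ?thesis
    by (simp add: residue_sum_altdef[OF degree_euler_op_power] coeff_euler_op_power cong: if_cong)
qed

section \<open>Exact formula for the partition counts\<close>

lemma partition_series_eq_geometric:
  assumes "0 < d" and a: "\<And>i. i \<in> {1..k} \<Longrightarrow> 0 < a i \<and> a i dvd d"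
  shows "partition_series a k =
    fps_of_poly (\<Prod>i=1..k. geometric_poly d (a i)) * partition_series (\<lambda>_. d) k"
proof -
  let ?P = "\<Prod>i=1..k. 1 - fps_X ^ a i :: real fps"
  let ?N = "fps_of_poly (\<Prod>i=1..k. geometric_poly d (a i))"
  have "(1 - fps_X ^ a i) * fps_of_poly (geometric_poly d (a i)) = (1 - fps_X ^ d :: real fps)"
    if "i \<in> {1..k}" for i
  proof -
    have "fps_of_poly ((monom 1 (a i) - 1) * geometric_poly d (a i)) = fps_of_poly (monom 1 d - 1)"
      using a[OF that] by (simp add: geometric_poly_mult)
    then have "(fps_X ^ a i - 1) * fps_of_poly (geometric_poly d (a i)) = (fps_X ^ d - 1 :: real fps)"
      by (simp add: fps_of_poly_mult fps_of_poly_diff fps_of_poly_monom')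
    then show ?thesis by (simp add: algebra_simps)
  qed
  then have "?P * ?N = (\<Prod>i=1..k. 1 - fps_X ^ d)"
    unfolding fps_of_poly_prod prod.distrib[symmetric] by (rule prod.cong[OF refl])
  then have *: "?P * (?N * partition_series (\<lambda>_. d) k) = 1"
    using partition_series_eq[of k "\<lambda>_. d"] \<open>0 < d\<close> by (simp add: mult.assoc[symmetric])
  \<comment> \<open>Both sides of the claim are inverses of \<open>?P\<close>, hence equal.\<close>
  have "partition_series a k = (?P * (?N * partition_series (\<lambda>_. d) k)) * partition_series a k"
    unfolding * by simp
  also have "\<dots> = (?P * partition_series a k) * (?N * partition_series (\<lambda>_. d) k)"
    by (simp only: mult_ac)
  also have "?P * partition_series a k = 1" by (rule partition_series_eq) (use a in auto)
  finally show ?thesis by simp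
qed

text \<open>Comparing coefficients in the factorization gives a convolution of \<open>N\<close> with
  binomial coefficients. The hypothesis \<open>degree N \<le> n\<close> keeps every
  \<open>n - t\<close> free of truncation, so the binomial coefficient at \<open>(n - t) / d\<close>
  may be written as the product of the factors \<open>n - t + l d\<close>, divided by
  \<open>d^K K!\<close>.\<close>

lemma restricted_partition_eq_sum:
  assumes "0 < d" and a: "\<And>i. i \<in> {1..Suc K} \<Longrightarrow> 0 < a i \<and> a i dvd d"
  defines "N \<equiv> \<Prod>i=1..Suc K. geometric_poly d (a i)"
  assumes "degree N \<le> n"
  shows "real (restricted_partition a (int n) (Suc K)) =
    (\<Sum>t\<le>degree N. if int d dvd int t - int n
       then coeff N t * (\<Prod>l=1..K. real n + (real l * real d - real t)) else 0) / (real d ^ K * fact K)"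
proof -
  have "real (restricted_partition a (int n) (Suc K)) = fps_nth (partition_series a (Suc K)) n"
    by (simp add: partition_series_def)
  also have "\<dots> = (\<Sum>t=0..n. coeff N t * real (restricted_partition (\<lambda>_. d) (int (n - t)) (Suc K)))"
    unfolding N_def by (subst partition_series_eq_geometric[where d = d])
      (use assms in \<open>auto simp: fps_mult_nth partition_series_def\<close>)
  also have "\<dots> = (\<Sum>t\<le>degree N. coeff N t * real (restricted_partition (\<lambda>_. d) (int (n - t)) (Suc K)))"
    by (rule sum.mono_neutral_right) (use assms(4) in \<open>auto simp: coeff_eq_0\<close>)
  also have "\<dots> = (\<Sum>t\<le>degree N. (if int d dvd int t - int n
       then coeff N t * (\<Prod>l=1..K. real n + (real l * real d - real t)) else 0) / (real d ^ K * fact K))"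
  proof (rule sum.cong[OF refl])
    fix t assume "t \<in> {..degree N}"
    then have t: "t \<le> n" using assms(4) by simp
    have dvd: "int d dvd int t - int n \<longleftrightarrow> d dvd n - t"
      using t by (metis dvd_diff_commute int_dvd_int_iff of_nat_diff)
    show "coeff N t * real (restricted_partition (\<lambda>_. d) (int (n - t)) (Suc K)) =
      (if int d dvd int t - int n
       then coeff N t * (\<Prod>l=1..K. real n + (real l * real d - real t)) else 0) / (real d ^ K * fact K)"
    proof (cases "d dvd n - t")
      case True
      then obtain u where u: "n - t = d * u" by (auto simp: dvd_def)
      then have "real n = real t + real d * real u"
        using t by (metis le_add_diff_inverse of_nat_add of_nat_mult)
      then have "(\<Prod>l=1..K. real n + (real l * real d - real t)) = (\<Prod>l=1..K. real d * (real u + real l))"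
        by (intro prod.cong) (auto simp: algebra_simps)
      also have "\<dots> = real d ^ K * (\<Prod>l=1..K. real u + real l)"
        by (simp add: prod.distrib)
      also have "(\<Prod>l=1..K. real u + real l) = fact K * real ((u + K) choose K)"
        by (simp add: binomial_eq_prod)
      finally have "(\<Prod>l=1..K. real n + (real l * real d - real t)) =
        real d ^ K * fact K * real ((u + K) choose K)" by simp
      moreover have "(n - t) div d = u" using u \<open>0 < d\<close> by simp
      ultimately show ?thesis unfolding dvd restricted_partition_const[OF \<open>0 < d\<close>]
        using True \<open>0 < d\<close> by simp
    next
      case False
      then show ?thesis unfolding dvd restricted_partition_const[OF \<open>0 < d\<close>] by simp
    qed
  qed
  finally show ?thesis by (simp add: sum_divide_distrib)
qed

lemma coeff_prod_nonneg:
  fixes f :: "'a \<Rightarrow> real poly"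
  assumes "\<And>i t. i \<in> I \<Longrightarrow> 0 \<le> coeff (f i) t"
  shows "0 \<le> coeff (\<Prod>i\<in>I. f i) t"
  using assms
proof (induction I arbitrary: t rule: infinite_finite_induct)
  case (insert i I)
  then show ?case by (auto simp: coeff_mult intro!: sum_nonneg mult_nonneg_nonneg)
qed (auto simp: coeff_1)

text \<open>Together with nonnegativity of the coefficients, this makes the total mass of the class
  of 0 positive.\<close>

lemma coeff_0_prod_geometric_poly:
  assumes "finite I" "0 < d" "\<And>i. i \<in> I \<Longrightarrow> 0 < a i \<and> a i dvd d"
  shows "coeff (\<Prod>i\<in>I. geometric_poly d (a i)) 0 = 1"
proof -
  have "coeff (geometric_poly d (a i)) 0 = 1" if "i \<in> I" for i
  proof -
    have "0 < d div a i" using assms(2) assms(3)[OF that]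
      by (simp add: div_greater_zero_iff dvd_imp_le)
    then have "coeff (geometric_poly d (a i)) 0 = (\<Sum>j<d div a i. if j = 0 then 1 else 0)"
      using assms(3)[OF that] unfolding geometric_poly_def coeff_sum by (intro sum.cong) auto
    then show ?thesis using \<open>0 < d div a i\<close> by simp
  qed
  then show ?thesis by (simp flip: poly_0_coeff_0 add: poly_prod)
qed

lemma degree_prod_geometric_poly: "degree (\<Prod>i\<in>I. geometric_poly d (a i)) \<le> card I * d"
proof -
  have "degree (\<Prod>i\<in>I. geometric_poly d (a i)) \<le> (\<Sum>i\<in>I. degree (geometric_poly d (a i)))"
    by (cases "finite I") (auto intro: degree_prod_sum_le[unfolded comp_def])
  also have "\<dots> \<le> (\<Sum>i\<in>I. d)" by (intro sum_mono degree_geometric_poly)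
  finally show ?thesis by simp
qed

subsection \<open>Second-order estimates\<close>

text \<open>The two sums are the first and second elementary symmetric polynomials in the
  \<open>x l\<close>. Adjoining \<open>y\<close> turns the remainder \<open>R\<close> into
  \<open>(1 + y) R + y S2\<close>, so the three bounds are proved in one induction, each feeding the
  next.\<close>

lemma prod_one_plus_second_order:
  fixes x :: "nat \<Rightarrow> real"
  assumes "\<And>l. l \<in> {1..K} \<Longrightarrow> \<bar>x l\<bar> \<le> \<epsilon>" "0 \<le> \<epsilon>"
  shows "\<bar>\<Sum>l=1..K. x l\<bar> \<le> real K * \<epsilon>"
    and "\<bar>\<Sum>l=1..K. x l * (\<Sum>j=1..<l. x j)\<bar> \<le> (real K * \<epsilon>)^2 / 2"
    and "\<bar>(\<Prod>l=1..K. 1 + x l) - (1 + (\<Sum>l=1..K. x l) + (\<Sum>l=1..K. x l * (\<Sum>j=1..<l. x j)))\<bar>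
      \<le> (1 + \<epsilon>)^K * (real K * \<epsilon>)^3 / 6"
proof -
  have "\<bar>\<Sum>l=1..K. x l\<bar> \<le> real K * \<epsilon> \<and>
    \<bar>\<Sum>l=1..K. x l * (\<Sum>j=1..<l. x j)\<bar> \<le> (real K * \<epsilon>)^2 / 2 \<and>
    \<bar>(\<Prod>l=1..K. 1 + x l) - (1 + (\<Sum>l=1..K. x l) + (\<Sum>l=1..K. x l * (\<Sum>j=1..<l. x j)))\<bar>
      \<le> (1 + \<epsilon>)^K * (real K * \<epsilon>)^3 / 6"
    using assms(1)
  proof (induction K)
    case (Suc K)
    define S1 where "S1 = (\<Sum>l=1..K. x l)"
    define S2 where "S2 = (\<Sum>l=1..K. x l * (\<Sum>j=1..<l. x j))"
    define R where "R = (\<Prod>l=1..K. 1 + x l) - (1 + S1 + S2)"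
    define y where "y = x (Suc K)"
    define k where "k = real K"
    have k: "0 \<le> k" "real (Suc K) = k + 1" by (auto simp: k_def)
    have y: "\<bar>y\<bar> \<le> \<epsilon>" using Suc.prems by (simp add: y_def)
    have IH: "\<bar>S1\<bar> \<le> k * \<epsilon>" "\<bar>S2\<bar> \<le> (k * \<epsilon>)^2 / 2" "\<bar>R\<bar> \<le> (1 + \<epsilon>)^K * (k * \<epsilon>)^3 / 6"
      using Suc.IH Suc.prems by (auto simp: S1_def S2_def R_def k_def)
    have eq1: "(\<Sum>l=1..Suc K. x l) = S1 + y" by (simp add: S1_def y_def)
    have eq2: "(\<Sum>l=1..Suc K. x l * (\<Sum>j=1..<l. x j)) = S2 + y * S1"
      by (simp add: S1_def S2_def y_def atLeastLessThanSuc_atLeastAtMost)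
    have eq3: "(\<Prod>l=1..Suc K. 1 + x l) - (1 + (S1 + y) + (S2 + y * S1)) = (1 + y) * R + y * S2"
      by (simp add: R_def S1_def S2_def y_def algebra_simps)
    have "\<bar>S1 + y\<bar> \<le> (k + 1) * \<epsilon>"
      using IH y by (simp add: algebra_simps)
    moreover have "\<bar>S2 + y * S1\<bar> \<le> ((k + 1) * \<epsilon>)^2 / 2"
    proof -
      have "\<bar>y * S1\<bar> \<le> \<epsilon> * (k * \<epsilon>)"
        unfolding abs_mult using IH y assms(2) by (intro mult_mono) auto
      then have "\<bar>S2 + y * S1\<bar> \<le> (k * \<epsilon>)^2 / 2 + \<epsilon> * (k * \<epsilon>)" using IH by linarith
      also have "\<dots> \<le> ((k + 1) * \<epsilon>)^2 / 2" by (simp add: power2_eq_square algebra_simps)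
      finally show ?thesis .
    qed
    moreover have "\<bar>(1 + y) * R + y * S2\<bar> \<le> (1 + \<epsilon>)^Suc K * ((k + 1) * \<epsilon>)^3 / 6"
    proof -
      have "\<bar>(1 + y) * R\<bar> \<le> (1 + \<epsilon>) * ((1 + \<epsilon>)^K * (k * \<epsilon>)^3 / 6)"
        unfolding abs_mult using IH y assms(2) by (intro mult_mono) auto
      moreover have "\<bar>y * S2\<bar> \<le> \<epsilon> * ((k * \<epsilon>)^2 / 2)"
        unfolding abs_mult using IH y assms(2) by (intro mult_mono) auto
      \<comment> \<open>The second term is enlarged by a factor at least 1 so that both terms share
        \<open>(1 + \<epsilon>)^Suc K\<close>.\<close>
      moreover have "1 * (\<epsilon> * ((k * \<epsilon>)^2 / 2)) \<le> (1 + \<epsilon>)^Suc K * (\<epsilon> * ((k * \<epsilon>)^2 / 2))"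
        using assms(2) by (intro mult_right_mono one_le_power) auto
      ultimately have "\<bar>(1 + y) * R + y * S2\<bar> \<le>
          (1 + \<epsilon>)^Suc K * ((k * \<epsilon>)^3 / 6) + (1 + \<epsilon>)^Suc K * (\<epsilon> * ((k * \<epsilon>)^2 / 2))"
        by simp
      also have "\<dots> = (1 + \<epsilon>)^Suc K * ((k * \<epsilon>)^3 / 6 + \<epsilon> * ((k * \<epsilon>)^2 / 2))"
        by (simp only: distrib_left)
      also have "\<dots> \<le> (1 + \<epsilon>)^Suc K * (((k + 1) * \<epsilon>)^3 / 6)"
      proof (rule mult_left_mono)
        have "((k + 1) * \<epsilon>)^3 / 6 - ((k * \<epsilon>)^3 / 6 + \<epsilon> * ((k * \<epsilon>)^2 / 2)) = (3 * k + 1) * \<epsilon>^3 / 6"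
          by (simp add: power3_eq_cube power2_eq_square field_simps)
        moreover have "0 \<le> (3 * k + 1) * \<epsilon>^3 / 6" using k assms(2) by simp
        ultimately show "(k * \<epsilon>)^3 / 6 + \<epsilon> * ((k * \<epsilon>)^2 / 2) \<le> ((k + 1) * \<epsilon>)^3 / 6" by linarith
      qed (use assms(2) in simp)
      finally show ?thesis by simp
    qed
    ultimately show ?case unfolding eq1 eq2 eq3 k by blast
  qed simp
  then show "\<bar>\<Sum>l=1..K. x l\<bar> \<le> real K * \<epsilon>"
    and "\<bar>\<Sum>l=1..K. x l * (\<Sum>j=1..<l. x j)\<bar> \<le> (real K * \<epsilon>)^2 / 2"
    and "\<bar>(\<Prod>l=1..K. 1 + x l) - (1 + (\<Sum>l=1..K. x l) + (\<Sum>l=1..K. x l * (\<Sum>j=1..<l. x j)))\<bar>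
      \<le> (1 + \<epsilon>)^K * (real K * \<epsilon>)^3 / 6"
    by blast+
qed

text \<open>The unperturbed quadratic gains at least \<open>1.19 m^2 n^2\<close>, whereas the
  perturbations, all of order \<open>m^2\<close>, cost less than \<open>0.53 m^2 n^2\<close>. The
  larger allowance for \<open>\<delta>m\<close> is \<open>3/2\<close> times the other one, matching
  \<open>n - m \<ge> 2n/3\<close>.\<close>

lemma perturbed_quadratic_log_concave:
  fixes n m \<alpha> \<beta> \<gamma> \<delta> \<delta>p \<delta>m :: real
  assumes "0 < m" "3 * m \<le> n" and \<gamma>: "0 \<le> \<gamma>" "33 * \<gamma> \<le> 10 * n"
    and \<alpha>: "\<bar>\<alpha>\<bar> \<le> \<gamma>" and \<beta>: "\<bar>\<beta>\<bar> \<le> \<gamma>^2 / 2"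
    and \<delta>: "\<bar>\<delta>\<bar> \<le> 7/100 * m^2" "\<bar>\<delta>p\<bar> \<le> 7/100 * m^2" "\<bar>\<delta>m\<bar> \<le> 21/200 * m^2"
  shows "((n + m)^2 + \<alpha> * (n + m) + \<beta> + \<delta>p) * ((n - m)^2 + \<alpha> * (n - m) + \<beta> + \<delta>m)
    < (n^2 + \<alpha> * n + \<beta> + \<delta>)^2"
proof -
  define q where "q = (\<lambda>x. x^2 + \<alpha> * x + \<beta>)"
  have n: "0 < n" using assms by linarith
  have m2: "m^2 \<le> n^2 / 9"
  proof -
    have "(3 * m)^2 \<le> n^2" using assms by (intro power_mono) auto
    then show ?thesis by (simp add: power_mult_distrib)
  qed
  have \<gamma>2: "\<gamma>^2 \<le> 100/1089 * n^2"
  proof -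
    have "(33 * \<gamma>)^2 \<le> (10 * n)^2" using assms by (intro power_mono) auto
    then show ?thesis by (simp add: power_mult_distrib)
  qed
  have \<alpha>x: "\<bar>\<alpha> * x\<bar> \<le> 10/33 * c * n^2" if "0 \<le> x" "x \<le> c * n" for x c
  proof -
    have "\<bar>\<alpha>\<bar> * \<bar>x\<bar> \<le> (10/33 * n) * (c * n)"
      using \<alpha> \<gamma> that n by (intro mult_mono) auto
    then show ?thesis by (simp add: abs_mult power2_eq_square algebra_simps)
  qed
  have x2: "x^2 \<le> c^2 * n^2" if "0 \<le> x" "x \<le> c * n" for x c
    using power_mono[of x "c * n" 2] that by (simp add: power_mult_distrib)
  have qle: "\<bar>q x\<bar> \<le> (c^2 + 10/33 * c + 50/1089) * n^2" if "0 \<le> x" "x \<le> c * n" for x c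
  proof -
    have "\<bar>q x\<bar> \<le> x^2 + \<bar>\<alpha> * x\<bar> + \<bar>\<beta>\<bar>"
      using abs_triangle_ineq[of "x^2 + \<alpha> * x" \<beta>] abs_triangle_ineq[of "x^2" "\<alpha> * x"]
      unfolding q_def by simp
    then show ?thesis
      using \<alpha>x[OF that] x2[OF that] \<beta> \<gamma>2 unfolding distrib_right by linarith
  qed
  \<comment> \<open>The value \<open>c = 1\<close> gives about 1.349; for
    \<open>n + m \<le> 4n/3\<close> the value \<open>c = 4/3\<close> gives about 2.228.\<close>
  have q1: "\<bar>q n\<bar> \<le> 136/100 * n^2"
    using qle[of n 1] n by (simp add: power2_eq_square algebra_simps)
  have q2: "\<bar>q (n - m)\<bar> \<le> 136/100 * n^2"
    using qle[of "n - m" 1] n assms(1,2) by (simp add: power2_eq_square algebra_simps)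
  have q3: "\<bar>q (n + m)\<bar> \<le> 23/10 * n^2"
    using qle[of "n + m" "4/3"] n assms(1,2) by (simp add: power2_eq_square algebra_simps)
  define M where "M = m^2 * n^2"
  have M: "0 < M" using assms n by (simp add: M_def)
  have prod_bound: "\<bar>u * v\<bar> \<le> (a * b) * M" if "\<bar>u\<bar> \<le> a * n^2" "\<bar>v\<bar> \<le> b * m^2" "0 \<le> a" for u v a b
  proof -
    have "\<bar>u\<bar> * \<bar>v\<bar> \<le> (a * n^2) * (b * m^2)"
      using that by (intro mult_mono) auto
    then show ?thesis by (simp add: abs_mult M_def mult_ac)
  qed
  have e0: "\<bar>q n * \<delta>\<bar> \<le> 136/100 * (7/100) * M" by (rule prod_bound[OF q1 \<delta>(1)]) simp
  have e1: "\<bar>q (n - m) * \<delta>p\<bar> \<le> 136/100 * (7/100) * M" by (rule prod_bound[OF q2 \<delta>(2)]) simp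
  have e2: "\<bar>q (n + m) * \<delta>m\<bar> \<le> 23/10 * (21/200) * M" by (rule prod_bound[OF q3 \<delta>(3)]) simp
  have e3: "\<bar>\<delta>p * \<delta>m\<bar> \<le> 1/100 * (21/200) * M"
    by (rule prod_bound[OF _ \<delta>(3)]) (use \<delta>(2) m2 in auto)
  \<comment> \<open>The exact gap of the unperturbed quadratic is \<open>m^2 * T\<close>. Dropping
    \<open>\<alpha>^2\<close>, the coefficient of \<open>n^2\<close> is at least
    \<open>2 - 20/33 - 100/1089 - 1/9\<close>, just above 1.19.\<close>
  define T where "T = 2 * n^2 + 2 * \<alpha> * n + \<alpha>^2 - 2 * \<beta> - m^2"
  have T: "119/100 * n^2 \<le> T"
  proof -
    have "\<bar>\<alpha> * n\<bar> \<le> 10/33 * n^2" using \<alpha>x[of n 1] n by simp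
    moreover have "2 * \<alpha> * n = 2 * (\<alpha> * n)" by simp
    ultimately show ?thesis
      using m2 \<beta> \<gamma>2 zero_le_power2[of \<alpha>] unfolding T_def abs_le_iff by linarith
  qed
  have id: "q n ^ 2 - q (n + m) * q (n - m) = m^2 * T"
    unfolding q_def T_def by (simp add: power2_eq_square algebra_simps)
  have "m^2 * (119/100 * n^2) \<le> m^2 * T" using T by (intro mult_left_mono) auto
  then have gain: "119/100 * M \<le> q n ^ 2 - q (n + m) * q (n - m)" unfolding id M_def by (simp add: mult_ac)
  have "(q n + \<delta>)^2 - (q (n + m) + \<delta>p) * (q (n - m) + \<delta>m) =
      (q n ^ 2 - q (n + m) * q (n - m)) + 2 * (q n * \<delta>) + \<delta>^2
      - q (n - m) * \<delta>p - q (n + m) * \<delta>m - \<delta>p * \<delta>m"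
    by (simp add: power2_eq_square algebra_simps)
  \<comment> \<open>The bound \<open>e0\<close> counts twice; \<open>\<delta>^2\<close> has the
    favourable sign.\<close>
  also have "\<dots> > 0"
    using gain e0 e1 e2 e3 M zero_le_power2[of \<delta>] unfolding abs_le_iff by linarith
  finally show ?thesis unfolding q_def by simp
qed

section \<open>Lower bound for the threshold\<close>

text \<open>For \<open>k \<ge> 7\<close> already \<open>k^(k-1)\<close> exceeds
  \<open>(k-1)^6\<close>. The small cases are computed, and \<open>k = 4\<close> is nearly tight:
  1458 against 1536.\<close>

lemma fact_power_ge:
  assumes "4 \<le> k"
  shows "2 * real (k - 1) ^ 6 \<le> fact k * real k ^ (k - 1)"
proof -
  consider "k = 4" | "k = 5" | "k = 6" | "7 \<le> k" using assms by linarith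
  then show ?thesis
  proof cases
    case 4
    have "real (k - 1) ^ 6 \<le> real k ^ 6" by (intro power_mono) auto
    also have "\<dots> \<le> real k ^ (k - 1)" using 4 by (intro power_increasing) auto
    finally have "real (k - 1) ^ 6 \<le> real k ^ (k - 1)" .
    moreover have "(2 :: real) \<le> fact k" using fact_mono[of 2 k, where 'a = real] 4 by simp
    ultimately show ?thesis by (intro mult_mono) auto
  qed (simp_all add: fact_numeral)
qed

text \<open>Dropping the summand 1 from each factor leaves \<open>k! k^(k-1) D^k\<close>, and
  \<open>D^k \<ge> D^3\<close>.\<close>

lemma prod_threshold_ge:
  assumes "4 \<le> k" "1 \<le> D"
  shows "2 * (real (k - 1) ^ 2 * D) ^ 3 \<le> 1 / real k * (\<Prod>i=1..k. 1 + real i * D * real k)"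
proof -
  have "2 * (real (k - 1) ^ 2 * D) ^ 3 = 2 * real (k - 1) ^ 6 * D ^ 3"
    by (simp add: power_mult_distrib flip: power_mult)
  also have "\<dots> \<le> (fact k * real k ^ (k - 1)) * D ^ k"
    using assms by (intro mult_mono fact_power_ge power_increasing) auto
  also have "\<dots> = 1 / real k * (\<Prod>i=1..k. real i * D * real k)"
  proof -
    have "(\<Prod>i=1..k. real i * D * real k) = fact k * D ^ k * real k ^ k"
      by (simp add: prod.distrib fact_prod)
    also have "real k ^ k = real k * real k ^ (k - 1)"
      using assms by (simp flip: power_Suc)
    finally show ?thesis using assms by simp
  qed
  also have "\<dots> \<le> 1 / real k * (\<Prod>i=1..k. 1 + real i * D * real k)"
    using assms by (intro mult_left_mono prod_mono) auto
  finally show ?thesis .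
qed

subsection \<open>Log-concavity\<close>

text \<open>Only the degrees in \<open>t\<close> matter: at most 2, so the weighted sums of these
  expressions over a residue class involve only moments of order 0, 1 and 2.\<close>

lemma sum_shifted_progression_polynomial:
  fixes d :: real
  shows "\<exists>b0 b1. \<forall>t. (\<Sum>l=1..K. real l * d - t) = b0 + b1 * t"
    and "\<exists>c0 c1 c2. \<forall>t. (\<Sum>l=1..K. (real l * d - t) * (\<Sum>j=1..<l. real j * d - t)) = c0 + c1 * t + c2 * t^2"
proof -
  have lin: "\<exists>b0 b1. \<forall>t. (\<Sum>l=1..K. real l * d - t) = b0 + b1 * t" for K
    by (intro exI[of _ "\<Sum>l=1..K. real l * d"] exI[of _ "- real K"]) (simp add: sum_subtractf)
  then show "\<exists>b0 b1. \<forall>t. (\<Sum>l=1..K. real l * d - t) = b0 + b1 * t" .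
  show "\<exists>c0 c1 c2. \<forall>t. (\<Sum>l=1..K. (real l * d - t) * (\<Sum>j=1..<l. real j * d - t)) = c0 + c1 * t + c2 * t^2"
  proof (induction K)
    case 0
    show ?case by (intro exI[of _ 0]) simp
  next
    case (Suc K)
    obtain c0 c1 c2 where c: "\<And>t. (\<Sum>l=1..K. (real l * d - t) * (\<Sum>j=1..<l. real j * d - t)) = c0 + c1 * t + c2 * t^2"
      using Suc by blast
    obtain b0 b1 where b: "\<And>t. (\<Sum>l=1..K. real l * d - t) = b0 + b1 * t" using lin by blast
    define q where "q = real (Suc K) * d"
    have "(\<Sum>l=1..Suc K. (real l * d - t) * (\<Sum>j=1..<l. real j * d - t)) =
      (c0 + q * b0) + (c1 + q * b1 - b0) * t + (c2 - b1) * t^2" for t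
    proof -
      have "(\<Sum>l=1..Suc K. (real l * d - t) * (\<Sum>j=1..<l. real j * d - t)) =
        (\<Sum>l=1..K. (real l * d - t) * (\<Sum>j=1..<l. real j * d - t)) + (q - t) * (\<Sum>l=1..K. real l * d - t)"
        by (simp add: q_def atLeastLessThanSuc_atLeastAtMost)
      then show ?thesis unfolding b c by (simp add: power2_eq_square algebra_simps)
    qed
    then show ?case by blast
  qed
qed

text \<open>After extracting \<open>n^(k-1)\<close> from the exact formula, each product is expanded
  to second order in \<open>1/n\<close>. The averages of the first two symmetric sums do not depend
  on the class of \<open>n\<close> and become \<open>\<alpha>\<close> and \<open>\<beta>\<close>;
  only the averaged remainder \<open>\<delta>\<close> may depend on it.\<close>

lemma restricted_partition_perturbed_quadratic:
  assumes k: "3 \<le> k" and "0 < d" and a: "\<And>i. i \<in> {1..k} \<Longrightarrow> 0 < a i \<and> a i dvd d"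
    and gcd: "\<And>S. S \<subseteq> {1..k} \<Longrightarrow> card S = k - 2 \<Longrightarrow> Gcd (a ` S) = 1"
  obtains C \<alpha> \<beta> :: real and \<delta> :: "nat \<Rightarrow> real" where
    "0 < C" "\<bar>\<alpha>\<bar> \<le> real (k - 1)^2 * real d" "\<bar>\<beta>\<bar> \<le> (real (k - 1)^2 * real d)^2 / 2"
    "\<And>n. k * d \<le> n \<Longrightarrow> real (restricted_partition a (int n) k) =
      C * real n ^ (k - 3) * (real n ^ 2 + \<alpha> * real n + \<beta> + \<delta> n)"
    "\<And>n. k * d \<le> n \<Longrightarrow> \<bar>\<delta> n\<bar> \<le>
      (1 + real (k - 1) * real d / real n) ^ (k - 1) * (real (k - 1)^2 * real d)^3 / (6 * real n)"
proof -
  define K where "K = k - 1"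
  have K: "k = Suc K" "2 \<le> K" using k by (auto simp: K_def)
  define N where "N = (\<Prod>i=1..Suc K. geometric_poly d (a i))"
  define E where "E = real K * real d"
  define e where "e = (\<lambda>l t. real l * real d - t)"
  define s1 where "s1 = (\<lambda>t. \<Sum>l=1..K. e l t)"
  define s2 where "s2 = (\<lambda>t. \<Sum>l=1..K. e l t * (\<Sum>j=1..<l. e j t))"
  define T where "T = (\<lambda>r. {t \<in> {..degree N}. int d dvd int t - r})"
  \<comment> \<open>\<open>A r f\<close> integrates \<open>f\<close> over the class of
    \<open>r\<close> with the coefficients of \<open>N\<close> as weights; \<open>H\<close> is the
    mass of a class, the same for all of them.\<close>
  define A where "A = (\<lambda>r f. \<Sum>t\<in>T r. coeff N t * f (real t))"
  define H where "H = A 0 (\<lambda>_. 1)"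
  have finT: "finite (T r)" for r by (simp add: T_def)
  have A_add: "A r (\<lambda>t. f t + g t) = A r f + A r g" for r f g
    by (simp add: A_def distrib_left sum.distrib)
  have A_mult: "A r (\<lambda>t. c * f t) = c * A r f" for r c f
    by (simp add: A_def sum_distrib_left mult_ac)
  have nonneg: "0 \<le> coeff N t" for t
    unfolding N_def by (intro coeff_prod_nonneg coeff_geometric_poly_nonneg)
  have deg: "degree N \<le> k * d"
    unfolding N_def using degree_prod_geometric_poly[of d a "{1..Suc K}"] K by simp
  have cube: "geometric_poly d 1 ^ 3 dvd N"
    unfolding N_def using gcd a \<open>0 < d\<close> K by (intro cube_dvd_prod_geometric_poly) auto
  have moment: "A r (\<lambda>t. t ^ i) = A 0 (\<lambda>t. t ^ i)" if "i \<le> 2" for r i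
  proof -
    have eq: "A r (\<lambda>t. t ^ i) = (\<Sum>t\<le>degree N. if int d dvd int t - r then real t ^ i * coeff N t else 0)" for r
      unfolding A_def T_def by (subst sum.inter_filter) (simp_all add: mult.commute cong: if_cong)
    show ?thesis unfolding eq by (rule residue_moment[OF \<open>0 < d\<close> cube that])
  qed
  have A_one: "A r (\<lambda>_. 1) = H" for r using moment[of 0 r] by (simp add: H_def)
  have A_quadratic: "A r (\<lambda>t. c0 + c1 * t + c2 * t^2) = A 0 (\<lambda>t. c0 + c1 * t + c2 * t^2)" for r c0 c1 c2
  proof -
    have "A r (\<lambda>t. c0 + c1 * t + c2 * t^2) = c0 * A r (\<lambda>t. t^0) + c1 * A r (\<lambda>t. t^1) + c2 * A r (\<lambda>t. t^2)" for r
      by (simp only: A_add A_mult[symmetric] power_0 power_one_right mult_1_right)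
    then show ?thesis using moment[of 0 r] moment[of 1 r] moment[of 2 r] by simp
  qed
  have s1: "A r s1 = A 0 s1" for r
  proof -
    obtain b0 b1 where "\<And>t. s1 t = b0 + b1 * t"
      unfolding s1_def e_def using sum_shifted_progression_polynomial(1) by blast
    then have "s1 = (\<lambda>t. b0 + b1 * t + 0 * t^2)" by auto
    then show ?thesis using A_quadratic by metis
  qed
  have s2: "A r s2 = A 0 s2" for r
  proof -
    obtain c0 c1 c2 where "\<And>t. s2 t = c0 + c1 * t + c2 * t^2"
      unfolding s2_def e_def using sum_shifted_progression_polynomial(2) by blast
    then have "s2 = (\<lambda>t. c0 + c1 * t + c2 * t^2)" by auto
    then show ?thesis using A_quadratic by metis
  qed
  have "0 < H"
  proof -
    have "coeff N 0 = 1" unfolding N_def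
      by (rule coeff_0_prod_geometric_poly) (use a \<open>0 < d\<close> K in auto)
    moreover have "0 \<in> T 0" by (simp add: T_def)
    then have "coeff N 0 * 1 \<le> H" unfolding H_def A_def
      by (intro member_le_sum) (use nonneg finT in auto)
    ultimately show ?thesis by simp
  qed
  have A_bound: "\<bar>A r f\<bar> \<le> B * H" if "\<And>t. t \<in> T r \<Longrightarrow> \<bar>f (real t)\<bar> \<le> B" for r f B
  proof -
    have "\<bar>A r f\<bar> \<le> (\<Sum>t\<in>T r. \<bar>coeff N t * f (real t)\<bar>)"
      unfolding A_def by (rule sum_abs)
    also have "\<dots> \<le> (\<Sum>t\<in>T r. B * coeff N t)"
    proof (rule sum_mono)
      fix t assume "t \<in> T r"
      then show "\<bar>coeff N t * f (real t)\<bar> \<le> B * coeff N t"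
        using that mult_left_mono[OF that nonneg, of t t] nonneg[of t]
        by (simp add: abs_mult mult.commute)
    qed
    also have "\<dots> = B * H" using A_one[of r] by (simp add: A_def flip: sum_distrib_left)
    finally show ?thesis .
  qed
  \<comment> \<open>With \<open>1 \<le> l \<le> K\<close> and
    \<open>0 \<le> t \<le> (K + 1) d\<close>, the number \<open>l d - t\<close> lies between
    \<open>- K d\<close> and \<open>K d\<close>.\<close>
  have e_bound: "\<bar>e l (real t)\<bar> \<le> E" if "l \<in> {1..K}" "t \<in> T r" for l t r
  proof -
    have "t \<le> k * d" using that deg by (auto simp: T_def)
    then have "real t \<le> (real K + 1) * real d" using K
      by (metis of_nat_Suc of_nat_le_iff of_nat_mult add.commute)
    moreover have "1 * real d \<le> real l * real d" "real l * real d \<le> real K * real d"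
      using that by (intro mult_right_mono; simp)+
    ultimately show ?thesis unfolding e_def E_def by (auto simp: abs_le_iff algebra_simps)
  qed
  have E0: "0 \<le> E" by (simp add: E_def)
  have KE: "real K * E = real (k - 1)^2 * real d" by (simp add: E_def K power2_eq_square)
  define \<alpha> where "\<alpha> = A 0 s1 / H"
  define \<beta> where "\<beta> = A 0 s2 / H"
  define R where "R = (\<lambda>n t. (\<Prod>l=1..K. 1 + e l t / real n) - (1 + s1 t / real n + s2 t / real n ^ 2))"
  \<comment> \<open>The factor \<open>n^2\<close> appears because \<open>n^K\<close> is split as
    \<open>n^(k-3)\<close> times \<open>n^2\<close>, and the latter is absorbed into the
    quadratic.\<close>
  define \<delta> where "\<delta> = (\<lambda>n. real n ^ 2 * A (int n) (R n) / H)"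
  show ?thesis
  proof (rule that[of "H / (real d ^ K * fact K)" \<alpha> \<beta> \<delta>])
    show "0 < H / (real d ^ K * fact K)" using \<open>0 < H\<close> \<open>0 < d\<close> by simp
    have "\<bar>A 0 s1\<bar> \<le> (real K * E) * H" unfolding s1_def
      by (rule A_bound, rule prod_one_plus_second_order(1)) (auto intro: e_bound E0)
    then show "\<bar>\<alpha>\<bar> \<le> real (k - 1)^2 * real d"
      unfolding \<alpha>_def KE[symmetric] using \<open>0 < H\<close> by (simp add: abs_divide divide_le_eq)
    have "\<bar>A 0 s2\<bar> \<le> ((real K * E)^2 / 2) * H" unfolding s2_def
      by (rule A_bound, rule prod_one_plus_second_order(2)) (auto intro: e_bound E0)
    then show "\<bar>\<beta>\<bar> \<le> (real (k - 1)^2 * real d)^2 / 2"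
      unfolding \<beta>_def KE[symmetric] using \<open>0 < H\<close> by (simp add: abs_divide divide_le_eq)
    fix n assume n: "k * d \<le> n"
    have "0 < k * d" using K \<open>0 < d\<close> by simp
    then have n0: "0 < real n" using n by linarith
    have "real (restricted_partition a (int n) (Suc K)) =
       A (int n) (\<lambda>t. \<Prod>l=1..K. real n + e l t) / (real d ^ K * fact K)"
    proof -
      have "real (restricted_partition a (int n) (Suc K)) =
        (\<Sum>t\<le>degree N. if int d dvd int t - int n
         then coeff N t * (\<Prod>l=1..K. real n + (real l * real d - real t)) else 0) / (real d ^ K * fact K)"
        unfolding N_def
        by (rule restricted_partition_eq_sum) (use a \<open>0 < d\<close> K deg n in \<open>auto simp: N_def\<close>)
      then show ?thesis unfolding A_def T_def e_def by (subst sum.inter_filter) simp_all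
    qed
    also have "(\<lambda>t. \<Prod>l=1..K. real n + e l t) = (\<lambda>t. real n ^ K * (\<Prod>l=1..K. 1 + e l t / real n))"
    proof
      fix t
      have "(\<Prod>l=1..K. real n + e l t) = (\<Prod>l=1..K. real n * (1 + e l t / real n))"
        using n0 by (intro prod.cong) (auto simp: field_simps)
      then show "(\<Prod>l=1..K. real n + e l t) = real n ^ K * (\<Prod>l=1..K. 1 + e l t / real n)"
        by (simp add: prod.distrib)
    qed
    also have "A (int n) \<dots> = real n ^ K * A (int n) (\<lambda>t. \<Prod>l=1..K. 1 + e l t / real n)"
      by (rule A_mult)
    also have "(\<lambda>t. \<Prod>l=1..K. 1 + e l t / real n) =
        (\<lambda>t. ((1 + (1 / real n) * s1 t) + (1 / real n ^ 2) * s2 t) + R n t)"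
      by (auto simp: R_def)
    also have "A (int n) \<dots> = H + (1 / real n) * A 0 s1 + (1 / real n ^ 2) * A 0 s2 + A (int n) (R n)"
      unfolding A_add A_mult A_one s1[of "int n"] s2[of "int n"] ..
    also have "\<dots> = H * (real n ^ 2 + \<alpha> * real n + \<beta> + \<delta> n) / real n ^ 2"
    proof -
      have "A 0 s1 = H * \<alpha>" "A 0 s2 = H * \<beta>" using \<open>0 < H\<close> by (simp_all add: \<alpha>_def \<beta>_def)
      moreover have "A (int n) (R n) = H * \<delta> n / real n ^ 2"
        using \<open>0 < H\<close> n0 by (simp add: \<delta>_def)
      moreover have "(1 / real n) * (H * \<alpha>) = H * (\<alpha> * real n) / real n ^ 2"
        using n0 by (simp add: power2_eq_square)
      moreover have "H = H * real n ^ 2 / real n ^ 2" using n0 by simp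
      ultimately show ?thesis by (simp add: distrib_left add_divide_distrib)
    qed
    also have "real n ^ K * (H * (real n ^ 2 + \<alpha> * real n + \<beta> + \<delta> n) / real n ^ 2)
        = real n ^ (k - 3) * (H * (real n ^ 2 + \<alpha> * real n + \<beta> + \<delta> n))"
    proof -
      have "real n ^ K = real n ^ (k - 3) * real n ^ 2"
        unfolding power_add[symmetric] using K by (intro arg_cong[where f = "(^) (real n)"]) simp
      then show ?thesis using n0 by simp
    qed
    finally show "real (restricted_partition a (int n) k) = H / (real d ^ K * fact K) *
      real n ^ (k - 3) * (real n ^ 2 + \<alpha> * real n + \<beta> + \<delta> n)"
      by (simp add: K(1) mult_ac)
    have "\<bar>A (int n) (R n)\<bar> \<le> ((1 + E / real n)^K * (real K * (E / real n))^3 / 6) * H"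
    proof (rule A_bound)
      fix t assume t: "t \<in> T (int n)"
      have "R n (real t) = (\<Prod>l=1..K. 1 + e l t / real n) - (1 + (\<Sum>l=1..K. e l t / real n) +
          (\<Sum>l=1..K. e l t / real n * (\<Sum>j=1..<l. e j t / real n)))"
        by (simp add: R_def s1_def s2_def power2_eq_square flip: sum_divide_distrib)
      also have "\<bar>\<dots>\<bar> \<le> (1 + E / real n)^K * (real K * (E / real n))^3 / 6"
        by (rule prod_one_plus_second_order(3))
          (use n0 e_bound[OF _ t] E0 in \<open>auto simp: divide_right_mono\<close>)
      finally show "\<bar>R n (real t)\<bar> \<le> (1 + E / real n)^K * (real K * (E / real n))^3 / 6" .
    qed
    then have "\<bar>A (int n) (R n)\<bar> / H \<le> (1 + E / real n)^K * (real K * (E / real n))^3 / 6"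
      using \<open>0 < H\<close> by (simp add: divide_le_eq)
    then have "real n ^ 2 * (\<bar>A (int n) (R n)\<bar> / H) \<le>
        real n ^ 2 * ((1 + E / real n)^K * (real K * (E / real n))^3 / 6)"
      by (rule mult_left_mono) simp
    also have "\<dots> = (1 + E / real n)^K * (real n ^ 2 * (real K * (E / real n))^3) / 6"
      by simp
    also have "real n ^ 2 * (real K * (E / real n))^3 = (real K * E)^3 / real n"
      using n0 by (simp add: field_simps power2_eq_square power3_eq_cube)
    finally show "\<bar>\<delta> n\<bar> \<le>
      (1 + real (k - 1) * real d / real n) ^ (k - 1) * (real (k - 1)^2 * real d)^3 / (6 * real n)"
      unfolding KE using \<open>0 < H\<close> by (simp add: \<delta>_def abs_mult E_def K mult.commute)
  qed
qed

text \<open>The power is at most \<open>exp (K E / x)\<close>, and \<open>1 + y + y^2\<close> at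
  \<open>y = 5/11\<close> is about 1.661. The ratio \<open>5/11\<close> is \<open>10/33\<close>
  times \<open>3/2\<close>: it comes from \<open>33 Y \<le> 10 n\<close> and
  \<open>x \<ge> 2n/3\<close> with \<open>Y = K E\<close>.\<close>

lemma one_plus_power_le:
  fixes x E Y :: real
  assumes "0 < x" "0 \<le> E" "11 * (real K * E) \<le> 5 * x"
  shows "(1 + E / x) ^ K \<le> 167 / 100"
proof -
  define y where "y = real K * E / x"
  have y: "0 \<le> y" "y \<le> 5 / 11" using assms by (auto simp: y_def divide_le_eq)
  have "(1 + E / x) ^ K \<le> exp (E / x) ^ K"
    using assms by (intro power_mono exp_ge_add_one_self) auto
  also have "\<dots> = exp y" by (simp add: y_def flip: exp_of_nat_mult)
  also have "\<dots> \<le> 1 + y + y^2" using y by (intro exp_bound) auto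
  also have "\<dots> \<le> 1 + 5/11 + (5/11)^2" using y by (intro add_mono power_mono) auto
  also have "\<dots> \<le> 167 / 100" by (simp add: power2_eq_square)
  finally show ?thesis .
qed

lemma restricted_partition_log_concave:
  assumes k: "4 \<le> k" and "0 < d" and a: "\<And>i. i \<in> {1..k} \<Longrightarrow> 0 < a i \<and> a i dvd d"
    and gcd: "\<And>S. S \<subseteq> {1..k} \<Longrightarrow> card S = k - 2 \<Longrightarrow> Gcd (a ` S) = 1"
    and m: "0 < m" "3 * m \<le> n"
    and large: "4 * (real (k - 1)^2 * real d)^3 \<le> real m ^ 2 * real n"
  shows "restricted_partition a (int n + int m) k * restricted_partition a (int n - int m) k
    < restricted_partition a (int n) k ^ 2"
proof -
  define Y where "Y = real (k - 1)^2 * real d"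
  have "9 \<le> real (k - 1)^2" using power_mono[of 3 "real (k - 1)" 2] k by simp
  then have Y: "0 < Y" unfolding Y_def using \<open>0 < d\<close> by (intro mult_pos_pos) auto
  have n: "0 < real n" "3 * real m \<le> real n" using m by auto
  have large': "4 * Y^3 \<le> real m ^ 2 * real n" using large by (simp add: Y_def)
  \<comment> \<open>From \<open>4 Y^3 \<le> m^2 n\<close> and \<open>9 m^2 \<le> n^2\<close> follows
    \<open>36 Y^3 \<le> n^3\<close>; the constant 33 works because
    \<open>33^3 = 35937 < 36000\<close>.\<close>
  have Yn: "33 * Y \<le> 10 * real n"
  proof (rule ccontr)
    assume "\<not> ?thesis"
    then have "(10 * real n)^3 < (33 * Y)^3" using n by (intro power_strict_mono) auto
    then have "1000 * real n^3 < 35937 * Y^3" by (simp add: power_mult_distrib)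
    moreover have "9 * (real m ^ 2 * real n) \<le> real n ^ 3"
    proof -
      have "(3 * real m)^2 \<le> real n ^ 2" using n by (intro power_mono) auto
      then have "(3 * real m)^2 * real n \<le> real n ^ 2 * real n" using n by (intro mult_right_mono) auto
      then show ?thesis by (simp add: power2_eq_square power3_eq_cube)
    qed
    moreover have "0 < Y^3" using Y by simp
    ultimately show False using large' by linarith
  qed
  obtain C \<alpha> \<beta> :: real and \<delta> :: "nat \<Rightarrow> real" where C: "0 < C"
    and \<alpha>: "\<bar>\<alpha>\<bar> \<le> Y" and \<beta>: "\<bar>\<beta>\<bar> \<le> Y^2 / 2"
    and rp: "\<And>n. k * d \<le> n \<Longrightarrow> real (restricted_partition a (int n) k) =
      C * real n ^ (k - 3) * (real n ^ 2 + \<alpha> * real n + \<beta> + \<delta> n)"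
    and \<delta>: "\<And>n. k * d \<le> n \<Longrightarrow> \<bar>\<delta> n\<bar> \<le>
      (1 + real (k - 1) * real d / real n) ^ (k - 1) * Y^3 / (6 * real n)"
    unfolding Y_def
    by (rule restricted_partition_perturbed_quadratic[of k d a]) (use k \<open>0 < d\<close> a gcd in auto)
  \<comment> \<open>The condition on \<open>x\<close> holds for \<open>n\<close>,
    \<open>n + m\<close> and, by \<open>3 m \<le> n\<close>, for \<open>n - m\<close>. It yields
    \<open>k d \<le> Y \<le> x\<close>, so the expansion is valid at all three points.\<close>
  have kd: "k * d \<le> x" if "2 * real n \<le> 3 * real x" for x
  proof -
    have "real k \<le> real (k - 1) ^ 2"
    proof -
      have "3 * real (k - 1) \<le> real (k - 1) ^ 2"
        using k unfolding power2_eq_square by (intro mult_right_mono) auto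
      moreover have "real k \<le> 3 * real (k - 1)" using k by simp
      ultimately show ?thesis by linarith
    qed
    then have "real k * real d \<le> Y" unfolding Y_def by (intro mult_right_mono) auto
    then have "real (k * d) \<le> real x" using that Yn Y by simp
    then show ?thesis by (simp only: of_nat_le_iff)
  qed
  \<comment> \<open>The constant is \<open>1.67 / 6\<close> times the \<open>1/4\<close> from
    \<open>4 Y^3 \<le> m^2 n\<close>, which is just below 0.07.\<close>
  have \<delta>_bound: "\<bar>\<delta> x\<bar> * real x \<le> 7/100 * (real m ^ 2 * real n)" if "2 * real n \<le> 3 * real x" for x
  proof -
    have x: "0 < real x" using that n by linarith
    have "(1 + real (k - 1) * real d / real x) ^ (k - 1) \<le> 167 / 100"
      using that Yn x by (intro one_plus_power_le) (auto simp: Y_def power2_eq_square mult.assoc)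
    then have "(1 + real (k - 1) * real d / real x) ^ (k - 1) * Y^3 \<le> 167 / 100 * Y^3"
      using Y by (intro mult_right_mono) auto
    then have "6 * (\<bar>\<delta> x\<bar> * real x) \<le> 167 / 100 * Y^3"
      using \<delta>[OF kd[OF that]] x by (simp add: le_divide_eq mult_ac)
    moreover have "0 < Y^3" using Y by simp
    ultimately show ?thesis using large' by linarith
  qed
  let ?q = "\<lambda>x. real x ^ 2 + \<alpha> * real x + \<beta> + \<delta> x"
  have nm: "real (n - m) = real n - real m" "real (n + m) = real n + real m"
    using m by (simp_all add: of_nat_diff)
  have less: "?q (n + m) * ?q (n - m) < ?q n ^ 2"
    unfolding nm
  proof (rule perturbed_quadratic_log_concave[where \<gamma> = Y])
    show "\<bar>\<delta> n\<bar> \<le> 7/100 * real m ^ 2" using \<delta>_bound[of n] n by simp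
    have "\<bar>\<delta> (n + m)\<bar> * real n \<le> \<bar>\<delta> (n + m)\<bar> * real (n + m)"
      by (intro mult_left_mono) auto
    also have "\<dots> \<le> 7/100 * (real m ^ 2 * real n)" by (rule \<delta>_bound) (use n in auto)
    finally show "\<bar>\<delta> (n + m)\<bar> \<le> 7/100 * real m ^ 2" using n by simp
    have "\<bar>\<delta> (n - m)\<bar> * (2/3 * real n) \<le> \<bar>\<delta> (n - m)\<bar> * real (n - m)"
      using n nm by (intro mult_left_mono) auto
    also have "\<dots> \<le> 7/100 * (real m ^ 2 * real n)" by (rule \<delta>_bound) (use n nm in auto)
    finally show "\<bar>\<delta> (n - m)\<bar> \<le> 21/200 * real m ^ 2" using n by simp
  qed (use m n Yn Y \<alpha> \<beta> in auto)
  \<comment> \<open>\<open>P\<close> and \<open>Q\<close> collect the factors outside the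
    quadratics, with \<open>P \<le> Q\<close> because
    \<open>(n + m) (n - m) \<le> n^2\<close>.\<close>
  define P where "P = C^2 * (real (n + m) * real (n - m)) ^ (k - 3)"
  define Q where "Q = C^2 * (real n ^ 2) ^ (k - 3)"
  have kds: "k * d \<le> n" "k * d \<le> n + m" "k * d \<le> n - m"
    by (rule kd; use n nm in simp)+
  have prod: "real (restricted_partition a (int (n + m)) k) * real (restricted_partition a (int (n - m)) k)
      = P * (?q (n + m) * ?q (n - m))"
    unfolding P_def rp[OF kds(2)] rp[OF kds(3)] by (simp add: power2_eq_square power_mult_distrib)
  have sq: "real (restricted_partition a (int n) k) ^ 2 = Q * ?q n ^ 2"
    unfolding Q_def rp[OF kds(1)] by (simp add: power_mult_distrib mult.commute flip: power_mult)
  have P: "0 < P" unfolding P_def using C m by simp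
  have PQ: "P \<le> Q" unfolding P_def Q_def
  proof (intro mult_left_mono power_mono)
    show "real (n + m) * real (n - m) \<le> real n ^ 2"
      unfolding nm by (simp add: power2_eq_square algebra_simps)
  qed auto
  \<comment> \<open>Replacing \<open>P\<close> by \<open>Q\<close> needs a nonnegative product of
    quadratics; this is read off from the nonnegativity of the partition counts.\<close>
  have "0 \<le> P * (?q (n + m) * ?q (n - m))" unfolding prod[symmetric] by simp
  then have "0 \<le> ?q (n + m) * ?q (n - m)" using P zero_le_mult_iff by (metis less_le_not_le)
  then have "P * (?q (n + m) * ?q (n - m)) \<le> Q * (?q (n + m) * ?q (n - m))"
    using PQ by (rule mult_right_mono[rotated])
  also have "\<dots> < Q * ?q n ^ 2"
    using less P PQ by (intro mult_strict_left_mono) auto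
  finally have "real (restricted_partition a (int (n + m)) k) * real (restricted_partition a (int (n - m)) k)
      < real (restricted_partition a (int n) k) ^ 2"
    unfolding prod sq .
  then show ?thesis using m by (simp add: of_nat_diff flip: of_nat_mult of_nat_power)
qed

theorem theorem3p1:
  fixes m :: nat
  assumes "m \<ge> 2"
  shows
   "(\<forall>(a :: nat \<Rightarrow> nat) (k :: nat).
       (\<forall>i\<ge>1. 0 < a i) \<and> (\<forall>i\<ge>1. a i \<le> a (Suc i)) \<and> k \<ge> 4 \<and>
       (\<forall>S. S \<subseteq> {1..k} \<and> card S = k - 2 \<longrightarrow> Gcd (a ` S) = 1) \<longrightarrow>
       (let D = Lcm (a ` {1..k});
            dh = (1 / real k) * (\<Prod>i=1..k. 1 + real i * real D * real k)
        in (if 2 * dh \<ge> 3 * real m ^ 3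
            then (\<forall>n::int. real_of_int n \<ge> dh \<longrightarrow>
                    restricted_partition a n k ^ 2 >
                    restricted_partition a (n + int m) k * restricted_partition a (n - int m) k)
            else (\<forall>n::int. n \<ge> 3 * int m \<longrightarrow>
                    restricted_partition a n k ^ 2 >
                    restricted_partition a (n + int m) k * restricted_partition a (n - int m) k))))
    \<and>
    (\<forall>(k::nat) (n::int). k \<ge> 2 \<and> n > 0 \<longrightarrow>
        restricted_partition (\<lambda>_. 1) n k ^ 2 >
        restricted_partition (\<lambda>_. 1) (n + int m) k * restricted_partition (\<lambda>_. 1) (n - int m) k)"
proof (intro conjI allI impI)
  fix k :: nat and n :: int
  assume "2 \<le> k \<and> 0 < n"
  then show "restricted_partition (\<lambda>_. 1) n k ^ 2 >
        restricted_partition (\<lambda>_. 1) (n + int m) k * restricted_partition (\<lambda>_. 1) (n - int m) k"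
    using assms by (intro log_concave_const_one) auto
next
  fix a :: "nat \<Rightarrow> nat" and k :: nat
  assume H: "(\<forall>i\<ge>1. 0 < a i) \<and> (\<forall>i\<ge>1. a i \<le> a (Suc i)) \<and> k \<ge> 4 \<and>
       (\<forall>S. S \<subseteq> {1..k} \<and> card S = k - 2 \<longrightarrow> Gcd (a ` S) = 1)"
  define D where "D = Lcm (a ` {1..k})"
  define dh where "dh = (1 / real k) * (\<Prod>i=1..k. 1 + real i * real D * real k)"
  define Y where "Y = real (k - 1)^2 * real D"
  have "0 < D" unfolding D_def using H by (intro Nat.gr0I) (auto simp: Lcm_0_iff)
  have dh: "2 * Y^3 \<le> dh" unfolding dh_def Y_def
    using H \<open>0 < D\<close> by (intro prod_threshold_ge) auto
  have goal: "restricted_partition a (n + int m) k * restricted_partition a (n - int m) k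
      < restricted_partition a n k ^ 2"
    if n: "3 * real m \<le> real_of_int n" "4 * Y^3 \<le> real m ^ 2 * real_of_int n" for n
  proof -
    have "0 \<le> n" using n by linarith
    then obtain u where u: "n = int u" by (metis zero_le_imp_eq_int)
    show ?thesis unfolding u
    proof (rule restricted_partition_log_concave[where d = D])
      show "0 < a i \<and> a i dvd D" if "i \<in> {1..k}" for i
        using that H by (auto simp: D_def)
    qed (use H \<open>0 < D\<close> assms n u in \<open>auto simp: Y_def\<close>)
  qed
  have m2: "4 \<le> real m ^ 2" using power_mono[of 2 "real m" 2] assms by simp
  have m3: "real m ^ 3 = real m ^ 2 * real m" by (simp add: power2_eq_square power3_eq_cube)
  have Y: "0 \<le> Y^3" by (simp add: Y_def)
  show "let D = Lcm (a ` {1..k});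
            dh = (1 / real k) * (\<Prod>i=1..k. 1 + real i * real D * real k)
        in (if 2 * dh \<ge> 3 * real m ^ 3
            then (\<forall>n::int. real_of_int n \<ge> dh \<longrightarrow>
                    restricted_partition a n k ^ 2 >
                    restricted_partition a (n + int m) k * restricted_partition a (n - int m) k)
            else (\<forall>n::int. n \<ge> 3 * int m \<longrightarrow>
                    restricted_partition a n k ^ 2 >
                    restricted_partition a (n + int m) k * restricted_partition a (n - int m) k))"
    unfolding Let_def D_def[symmetric] dh_def[symmetric]
  proof (split if_split, intro conjI impI allI)
    fix n :: int
    assume "3 * real m ^ 3 \<le> 2 * dh" "dh \<le> real_of_int n"
    \<comment> \<open>Here \<open>12 m \<le> 3 m^3 \<le> 2 n\<close> gives
      \<open>3 m \<le> n\<close>, and \<open>m^2 n \<ge> 4 n \<ge> 4 dh \<ge> 8 Y^3\<close>.\<close>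
    moreover have "4 * real m \<le> real m ^ 3" unfolding m3 using m2 by (intro mult_right_mono) auto
    moreover have "4 * real_of_int n \<le> real m ^ 2 * real_of_int n"
      using m2 dh Y \<open>dh \<le> real_of_int n\<close> by (intro mult_right_mono) linarith+
    ultimately show "restricted_partition a (n + int m) k * restricted_partition a (n - int m) k
      < restricted_partition a n k ^ 2"
      using dh Y by (intro goal) auto
  next
    fix n :: int
    assume "\<not> 3 * real m ^ 3 \<le> 2 * dh" and n: "3 * int m \<le> n"
    moreover have n': "3 * real m \<le> real_of_int n" using n by linarith
    \<comment> \<open>Here the small threshold helps:
      \<open>m^2 n \<ge> 3 m^3 > 2 dh \<ge> 4 Y^3\<close>.\<close>
    moreover have "real m ^ 2 * (3 * real m) \<le> real m ^ 2 * real_of_int n"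
      using n' by (intro mult_left_mono) auto
    ultimately show "restricted_partition a (n + int m) k * restricted_partition a (n - int m) k
      < restricted_partition a n k ^ 2"
      using dh m3 by (intro goal) auto
  qed
qed

end
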